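(* Let $\mathbf{k}$ be a field of characteristic zero, let $S$ be an affine, saturated, pointed semigroup minimally embedded in $M\cong\mathbb{Z}^n$, and let $I$ be a monomial ideal of $\mathbf{k}[S]$. A liftable homogeneous derivation $\overline{\partial}_{\alpha,p}\colon\mathbf{k}[S]/I\to\mathbf{k}[S]/I$ with $p\in N_{\mathbf{k}}$ and $\alpha\in M$ is locally nilpotent if and only if one of the following holds: (i) $\alpha\in\mathcal{R}_\rho(I)$ and $p=\lambda\cdot\rho$ with $\rho\in S^\vee(1)$ and $\lambda\in\mathbf{k}$; or (ii) $\alpha\in S$ and $(\mathbb{Z}_{\geq 0}\cdot\alpha)\cap\operatorname{supp}(I)\neq\emptyset$; or (iii) $\alpha\in S$, $(\mathbb{Z}_{\geq 0}\cdot\alpha)\cap\operatorname{supp}(I)=\emptyset$, and $(m+\mathbb{Z}_{\geq 0}\cdot\alpha)\cap\operatorname{supp}(I)\neq\emptyset$ for all $m\in S\setminus p^\perp$.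
   Context: An affine semigroup $S$ is a finitely generated commutative semigroup with identity embeddable in a lattice; it is minimally embedded in $M\cong\mathbb{Z}^n$ if it generates $M$ as a group. With $\omega_S\subset M\otimes\mathbb{R}$ the cone spanned by $S$, $S$ is saturated if $\omega_S\cap M=S$ and pointed if $\omega_S$ contains no nonzero vector space. Let $N=\operatorname{Hom}(M,\mathbb{Z})$ and $N_{\mathbf{k}}=N\otimes_{\mathbb{Z}}\mathbf{k}$; elements $p\in N_{\mathbf{k}}$ are viewed as homomorphisms $M\to\mathbf{k}$, and $p^\perp=\{m\in M\mid p(m)=0\}$. $\mathbf{k}[S]=\bigoplus_{m\in S}\mathbf{k}\cdot\mathbf{x}^m$ with $\mathbf{x}^m\mathbf{x}^{m'}=\mathbf{x}^{m+m'}$, $\mathbf{x}^0=1$. A monomial ideal is $I=(\mathbf{x}^{\mathbf{a}_1},\dots,\mathbf{x}^{\mathbf{a}_l})$ with $\mathbf{a}_i\in S$; $\operatorname{supp}(I)=\{m\in S\mid\mathbf{x}^m\in I\}$. The dual semigroup is $S^\vee=\{p\in N\mid p(m)\ge 0\text{ for all }m\in S\}$. A face of a semigroup is a subsemigroup $S'$ such that $m+m'\in S'$ implies $m,m'\in S'$; a ray is a face isomorphic to $\mathbb{Z}_{\ge 0}$; $S^\vee(1)$ is the set of the generators of the rays of $S^\vee$. For $\rho\in S^\vee(1)$ let $$\mathcal{R}_\rho=\{\alpha\in M\mid\rho(\alpha)=-1,\ \rho'(\alpha)\ge 0\text{ for all }\rho'\in S^\vee(1)\setminus\{\rho\}\},$$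 $$\mathcal{R}_\rho(I)=\{\alpha\in\mathcal{R}_\rho\mid \mathbf{a}_i+\alpha\in\operatorname{supp}(I)\text{ for all }\mathbf{a}_i\notin\rho^\perp\}.$$ $\partial_{\alpha,p}$ denotes the map $\mathbf{x}^m\mapsto p(m)\mathbf{x}^{m+\alpha}$. The homogeneous derivations (for the $M$-grading) of $\mathbf{k}[S]$ that preserve $I$ are the $\partial_{\alpha,p}$ with either $\alpha\in S$ and $p\in N_{\mathbf{k}}$ arbitrary (inner), or $\alpha\in\mathcal{R}_\rho(I)$ for some $\rho\in S^\vee(1)$ and $p\in\mathbf{k}\cdot\rho$ (outer). A derivation of $\mathbf{k}[S]/I$ is liftable if it is induced by a derivation $\partial$ of $\mathbf{k}[S]$ with $\partial(I)\subset I$. Every liftable homogeneous derivation of $\mathbf{k}[S]/I$ is induced by such a $\partial_{\alpha,p}$, and is then denoted $\overline{\partial}_{\alpha,p}$. A derivation $\partial$ of $B$ is locally nilpotent if for each $f\in B$ there is $\ell$ with $\partial^\ell(f)=0$. *)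

theory Defs
  imports
    "HOL-Analysis.Analysis"
    "HOL-Algebra.QuotRing"
    "HOL-Library.Poly_Mapping"
    "HOL-Library.Function_Algebras"
begin

section \<open>Lattices and affine semigroups\<close>

text \<open>
  The lattice \<open>M\<close> is a whole type \<open>'m\<close> of class \<^class>\<open>ab_group_add\<close>, and \<open>M \<otimes> \<real>\<close> is a real vector
  space type \<open>'v\<close> together with the canonical map \<open>\<iota>\<close>. The predicate below says that \<open>M\<close> is
  isomorphic to \<open>\<int>\<^sup>n\<close> and that \<open>\<iota>\<close> corresponds to the inclusion of \<open>\<int>\<^sup>n\<close> into \<open>\<real>\<^sup>n\<close>. Tuples are
  functions on \<^typ>\<open>nat\<close> that vanish from \<open>n\<close> on, so that \<open>n = 0\<close> is allowed.
\<close>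

definition lattice_in_realification ::
    "nat \<Rightarrow> ('m::ab_group_add \<Rightarrow> 'v::real_vector) \<Rightarrow> bool" where
  "lattice_in_realification n \<iota> \<longleftrightarrow>
     (\<exists>\<phi> \<psi>.
        (\<forall>i. Modules.additive (\<lambda>m. \<phi> m i)) \<and>
        bij_betw \<phi> (UNIV :: 'm set) {c :: nat \<Rightarrow> int. \<forall>i\<ge>n. c i = 0} \<and>
        (\<forall>i. linear (\<lambda>v. \<psi> v i)) \<and>
        bij_betw \<psi> (UNIV :: 'v set) {c :: nat \<Rightarrow> real. \<forall>i\<ge>n. c i = 0} \<and>
        (\<forall>m i. \<psi> (\<iota> m) i = real_of_int (\<phi> m i)))"

definition add_submonoid :: "'a::comm_monoid_add set \<Rightarrow> bool" where
  "add_submonoid T \<longleftrightarrow> 0 \<in> T \<and> (\<forall>x\<in>T. \<forall>y\<in>T. x + y \<in> T)"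

definition add_subgroup :: "'a::ab_group_add set \<Rightarrow> bool" where
  "add_subgroup T \<longleftrightarrow> 0 \<in> T \<and> (\<forall>x\<in>T. \<forall>y\<in>T. x + y \<in> T) \<and> (\<forall>x\<in>T. - x \<in> T)"

definition affine_semigroup :: "'m::ab_group_add set \<Rightarrow> bool" where
  "affine_semigroup S \<longleftrightarrow> (\<exists>G. finite G \<and> S = add_submonoid hull G)"

definition minimally_embedded :: "'m::ab_group_add set \<Rightarrow> bool" where
  "minimally_embedded S \<longleftrightarrow> add_subgroup hull S = UNIV"

definition semigroup_cone :: "('m \<Rightarrow> 'v::real_vector) \<Rightarrow> 'm set \<Rightarrow> 'v set" where
  "semigroup_cone \<iota> S = convex_cone hull (\<iota> ` S)"

definition saturated :: "('m \<Rightarrow> 'v::real_vector) \<Rightarrow> 'm set \<Rightarrow> bool" where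
  "saturated \<iota> S \<longleftrightarrow> {m. \<iota> m \<in> semigroup_cone \<iota> S} = S"

definition pointed :: "('m \<Rightarrow> 'v::real_vector) \<Rightarrow> 'm set \<Rightarrow> bool" where
  "pointed \<iota> S \<longleftrightarrow> (\<forall>W. subspace W \<and> W \<subseteq> semigroup_cone \<iota> S \<longrightarrow> W = {0})"

definition nat_multiples :: "'a::comm_monoid_add \<Rightarrow> 'a set" where
  "nat_multiples x = range (\<lambda>k::nat. \<Sum>i<k. x)"


section \<open>Dual semigroup, rays and roots\<close>

definition dual_semigroup :: "'m::ab_group_add set \<Rightarrow> ('m \<Rightarrow> int) set" where
  "dual_semigroup S = {p. Modules.additive p \<and> (\<forall>m\<in>S. p m \<ge> 0)}"

definition semigroup_face :: "'a::comm_monoid_add set \<Rightarrow> 'a set \<Rightarrow> bool" where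
  "semigroup_face T F \<longleftrightarrow>
     F \<subseteq> T \<and> add_submonoid F \<and> (\<forall>x\<in>T. \<forall>y\<in>T. x + y \<in> F \<longrightarrow> x \<in> F \<and> y \<in> F)"

definition semigroup_ray :: "'a::comm_monoid_add set \<Rightarrow> 'a set \<Rightarrow> bool" where
  "semigroup_ray T F \<longleftrightarrow>
     semigroup_face T F \<and>
     (\<exists>\<phi> :: nat \<Rightarrow> 'a. bij_betw \<phi> UNIV F \<and> (\<forall>i j. \<phi> (i + j) = \<phi> i + \<phi> j))"

definition ray_generators :: "'a::comm_monoid_add set \<Rightarrow> 'a set" where
  "ray_generators T = {\<rho>. \<exists>F. semigroup_ray T F \<and> F = nat_multiples \<rho>}"

definition dual_rays :: "'m::ab_group_add set \<Rightarrow> ('m \<Rightarrow> int) set" where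
  "dual_rays S = ray_generators (dual_semigroup S)"

definition roots :: "'m::ab_group_add set \<Rightarrow> ('m \<Rightarrow> int) \<Rightarrow> 'm set" where
  "roots S \<rho> = {\<alpha>. \<rho> \<alpha> = -1 \<and> (\<forall>\<rho>' \<in> dual_rays S - {\<rho>}. \<rho>' \<alpha> \<ge> 0)}"


section \<open>The semigroup algebra and its monomial ideals\<close>

text \<open>
  The type \<open>'m \<Rightarrow>\<^sub>0 'k\<close> carries the convolution product, i.e. it is the group algebra of \<open>M\<close>;
  the algebra of \<open>S\<close> is the subring of elements supported in \<open>S\<close>.
\<close>

definition semigroup_algebra :: "'m::ab_group_add set \<Rightarrow> ('m \<Rightarrow>\<^sub>0 'k::field_char_0) ring" where
  "semigroup_algebra S =
     \<lparr>carrier = {f. Poly_Mapping.keys f \<subseteq> S}, mult = (*), one = 1, zero = 0, add = (+)\<rparr>"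

definition mono_x :: "'m::ab_group_add \<Rightarrow> ('m \<Rightarrow>\<^sub>0 'k::field_char_0)" where
  "mono_x m = Poly_Mapping.single m 1"

definition monomial_ideal :: "'m::ab_group_add set \<Rightarrow> 'm set \<Rightarrow> ('m \<Rightarrow>\<^sub>0 'k::field_char_0) set" where
  "monomial_ideal S A = Idl\<^bsub>semigroup_algebra S\<^esub> (mono_x ` A)"

definition ideal_supp :: "'m::ab_group_add set \<Rightarrow> ('m \<Rightarrow>\<^sub>0 'k::field_char_0) set \<Rightarrow> 'm set" where
  "ideal_supp S I = {m \<in> S. mono_x m \<in> I}"

text \<open>Here \<open>A\<close> is the set of exponents of the given monomial generators of \<open>I\<close>.\<close>

definition roots_ideal ::
    "'m::ab_group_add set \<Rightarrow> 'm set \<Rightarrow> ('m \<Rightarrow>\<^sub>0 'k::field_char_0) set \<Rightarrow> ('m \<Rightarrow> int) \<Rightarrow> 'm set" where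
  "roots_ideal S A I \<rho> =
     {\<alpha> \<in> roots S \<rho>. \<forall>a\<in>A. \<rho> a \<noteq> 0 \<longrightarrow> a + \<alpha> \<in> ideal_supp S I}"


section \<open>Derivations\<close>

text \<open>
  Derivations of the \<open>'k\<close>-algebra \<open>R\<close> with structure map \<open>c\<close>; the values of \<open>D\<close> outside the carrier
  play no role.
\<close>

definition alg_derivation :: "('k \<Rightarrow> 'a) \<Rightarrow> ('a, 'b) ring_scheme \<Rightarrow> ('a \<Rightarrow> 'a) \<Rightarrow> bool" where
  "alg_derivation c R D \<longleftrightarrow>
     D \<in> carrier R \<rightarrow> carrier R \<and>
     (\<forall>x\<in>carrier R. \<forall>y\<in>carrier R. D (x \<oplus>\<^bsub>R\<^esub> y) = D x \<oplus>\<^bsub>R\<^esub> D y) \<and>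
     (\<forall>t. \<forall>x\<in>carrier R. D (c t \<otimes>\<^bsub>R\<^esub> x) = c t \<otimes>\<^bsub>R\<^esub> D x) \<and>
     (\<forall>x\<in>carrier R. \<forall>y\<in>carrier R.
        D (x \<otimes>\<^bsub>R\<^esub> y) = (D x \<otimes>\<^bsub>R\<^esub> y) \<oplus>\<^bsub>R\<^esub> (x \<otimes>\<^bsub>R\<^esub> D y))"

definition locally_nilpotent :: "('a, 'b) ring_scheme \<Rightarrow> ('a \<Rightarrow> 'a) \<Rightarrow> bool" where
  "locally_nilpotent R D \<longleftrightarrow> (\<forall>x\<in>carrier R. \<exists>l. (D ^^ l) x = \<zero>\<^bsub>R\<^esub>)"

definition derivation_algebra ::
    "'m::ab_group_add set \<Rightarrow> (('m \<Rightarrow>\<^sub>0 'k::field_char_0) \<Rightarrow> ('m \<Rightarrow>\<^sub>0 'k)) \<Rightarrow> bool" where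
  "derivation_algebra S d \<longleftrightarrow>
     alg_derivation (\<lambda>t. Poly_Mapping.single 0 t) (semigroup_algebra S) d"

definition derivation_quotient ::
    "'m::ab_group_add set \<Rightarrow> ('m \<Rightarrow>\<^sub>0 'k::field_char_0) set \<Rightarrow>
     (('m \<Rightarrow>\<^sub>0 'k) set \<Rightarrow> ('m \<Rightarrow>\<^sub>0 'k) set) \<Rightarrow> bool" where
  "derivation_quotient S I D \<longleftrightarrow>
     alg_derivation (\<lambda>t. I +>\<^bsub>semigroup_algebra S\<^esub> Poly_Mapping.single 0 t)
       (semigroup_algebra S Quot I) D"

definition induces ::
    "'m::ab_group_add set \<Rightarrow> ('m \<Rightarrow>\<^sub>0 'k::field_char_0) set \<Rightarrow>
     (('m \<Rightarrow>\<^sub>0 'k) \<Rightarrow> ('m \<Rightarrow>\<^sub>0 'k)) \<Rightarrow> (('m \<Rightarrow>\<^sub>0 'k) set \<Rightarrow> ('m \<Rightarrow>\<^sub>0 'k) set) \<Rightarrow> bool" where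
  "induces S I d D \<longleftrightarrow>
     (\<forall>f\<in>carrier (semigroup_algebra S).
        D (I +>\<^bsub>semigroup_algebra S\<^esub> f) = I +>\<^bsub>semigroup_algebra S\<^esub> d f)"

definition liftable ::
    "'m::ab_group_add set \<Rightarrow> ('m \<Rightarrow>\<^sub>0 'k::field_char_0) set \<Rightarrow>
     (('m \<Rightarrow>\<^sub>0 'k) set \<Rightarrow> ('m \<Rightarrow>\<^sub>0 'k) set) \<Rightarrow> bool" where
  "liftable S I D \<longleftrightarrow>
     derivation_quotient S I D \<and>
     (\<exists>d. derivation_algebra S d \<and> d ` I \<subseteq> I \<and> induces S I d D)"

text \<open>The graded piece of degree \<open>m\<close> of the quotient; it is zero unless \<open>m \<in> S\<close>.\<close>

definition quotient_component ::
    "'m::ab_group_add set \<Rightarrow> ('m \<Rightarrow>\<^sub>0 'k::field_char_0) set \<Rightarrow> 'm \<Rightarrow> ('m \<Rightarrow>\<^sub>0 'k) set set" where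
  "quotient_component S I m =
     (\<lambda>f. I +>\<^bsub>semigroup_algebra S\<^esub> f) `
       {f \<in> carrier (semigroup_algebra S). Poly_Mapping.keys f \<subseteq> {m}}"

definition homogeneous ::
    "'m::ab_group_add set \<Rightarrow> ('m \<Rightarrow>\<^sub>0 'k::field_char_0) set \<Rightarrow>
     (('m \<Rightarrow>\<^sub>0 'k) set \<Rightarrow> ('m \<Rightarrow>\<^sub>0 'k) set) \<Rightarrow> bool" where
  "homogeneous S I D \<longleftrightarrow>
     (\<exists>\<beta>. \<forall>m. D ` quotient_component S I m \<subseteq> quotient_component S I (m + \<beta>))"

text \<open>
  The linear map sending \<open>x\<^sup>m\<close> to \<open>p(m) x\<^bsup>m+\<alpha>\<^esup>\<close>, written on the whole group algebra of \<open>M\<close>.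
  Elements \<open>p\<close> of \<open>N \<otimes> k\<close> are represented as additive maps \<open>M \<rightarrow> k\<close>.
\<close>

definition partial_map ::
    "'m::ab_group_add \<Rightarrow> ('m \<Rightarrow> 'k::field_char_0) \<Rightarrow> ('m \<Rightarrow>\<^sub>0 'k) \<Rightarrow> ('m \<Rightarrow>\<^sub>0 'k)" where
  "partial_map \<alpha> p f =
     (\<Sum>m\<in>Poly_Mapping.keys f. Poly_Mapping.single (m + \<alpha>) (p m * Poly_Mapping.lookup f m))"

definition ray_line :: "('m::ab_group_add \<Rightarrow> int) \<Rightarrow> ('m \<Rightarrow> 'k::field_char_0) set" where
  "ray_line \<rho> = range (\<lambda>c m. c * of_int (\<rho> m))"

definition inner_pair :: "'m::ab_group_add set \<Rightarrow> 'm \<Rightarrow> ('m \<Rightarrow> 'k::field_char_0) \<Rightarrow> bool" where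
  "inner_pair S \<alpha> p \<longleftrightarrow> \<alpha> \<in> S \<and> Modules.additive p"

definition outer_pair ::
    "'m::ab_group_add set \<Rightarrow> 'm set \<Rightarrow> ('m \<Rightarrow>\<^sub>0 'k::field_char_0) set \<Rightarrow>
     'm \<Rightarrow> ('m \<Rightarrow> 'k) \<Rightarrow> bool" where
  "outer_pair S A I \<alpha> p \<longleftrightarrow> (\<exists>\<rho>\<in>dual_rays S. \<alpha> \<in> roots_ideal S A I \<rho> \<and> p \<in> ray_line \<rho>)"

text \<open>
  \<open>D\<close> is the liftable homogeneous derivation denoted by a bar over \<open>\<partial>\<close> with index \<open>\<alpha>, p\<close>. The
  notation is available for inner and outer pairs only; for the remaining pairs with \<open>p = 0\<close> the
  formula would still define the zero map, for which \<open>\<alpha>\<close> would be an arbitrary label.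
\<close>

definition liftable_homogeneous_derivation ::
    "'m::ab_group_add set \<Rightarrow> 'm set \<Rightarrow> ('m \<Rightarrow>\<^sub>0 'k::field_char_0) set \<Rightarrow>
     'm \<Rightarrow> ('m \<Rightarrow> 'k) \<Rightarrow> (('m \<Rightarrow>\<^sub>0 'k) set \<Rightarrow> ('m \<Rightarrow>\<^sub>0 'k) set) \<Rightarrow> bool" where
  "liftable_homogeneous_derivation S A I \<alpha> p D \<longleftrightarrow>
     liftable S I D \<and> homogeneous S I D \<and>
     (inner_pair S \<alpha> p \<or> outer_pair S A I \<alpha> p) \<and>
     induces S I (partial_map \<alpha> p) D"

end

theory Submission
  imports Defs
begin

text \<open>
  On monomials the iterates of \<open>\<partial>\<close> with index \<open>\<alpha>, p\<close> are explicit: \<open>\<partial>\<^sup>l\<close> sends \<open>x\<^sup>m\<close> to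
  \<open>x\<^bsup>m+l\<alpha>\<^esup>\<close> times the product of the scalars \<open>p(m) + i p(\<alpha>)\<close> with \<open>i < l\<close>. As \<open>I\<close> is an ideal
  stable under \<open>\<partial>\<close>, the elements that some power of \<open>\<partial>\<close> moves into \<open>I\<close> are closed under sums, so
  local nilpotency need only be tested on monomials. This gives the criterion
  \<open>locally_nilpotent_iff_monomials\<close>: for every \<open>m \<in> S\<close> there is an \<open>l\<close> such that \<open>m + l\<alpha>\<close> lies in
  the support of \<open>I\<close> or one of these scalars vanishes.

  If \<open>\<alpha>\<close> is a root for \<open>\<rho>\<close> and \<open>p\<close> is a multiple of \<open>\<rho>\<close>, then \<open>\<rho>(m) + i \<rho>(\<alpha>) = \<rho>(m) - i\<close>
  reaches zero for every \<open>m \<in> S\<close>. If \<open>\<alpha> \<in> S\<close>, then \<open>(ii)\<close> and \<open>(iii)\<close> push every monomial that \<open>\<partial>\<close>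
  does not kill at once into \<open>I\<close>. For the converse with \<open>\<alpha> \<in> S\<close>, suppose that no multiple of \<open>\<alpha>\<close>
  is in the support. The criterion at \<open>m = \<alpha>\<close> involves the scalars \<open>(i + 1) p(\<alpha>)\<close>, which in
  characteristic zero vanish only if \<open>p(\<alpha>) = 0\<close>. But then all scalars at a general \<open>m\<close> are equal to
  \<open>p(m)\<close>, and the criterion becomes \<open>(iii)\<close>.

  The formula for \<open>\<partial>\<close> is written on the whole group algebra of \<open>M\<close>; that \<open>\<partial>\<close> preserves
  \<open>k[S]\<close> and \<open>I\<close> is recovered from the map that it induces on the quotient, in
  \<open>induced_map_preserves_algebra\<close> and \<open>induced_map_preserves_ideal\<close>.
\<close>

section \<open>The semigroup algebra as a ring\<close>

lemma add_submonoid_hull: "add_submonoid (add_submonoid hull G)"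
  by (rule hull_in) (auto simp: add_submonoid_def)

lemma semigroup_algebra_simps [simp]:
  "carrier (semigroup_algebra S) = {f. Poly_Mapping.keys f \<subseteq> S}"
  "x \<otimes>\<^bsub>semigroup_algebra S\<^esub> y = x * y"
  "x \<oplus>\<^bsub>semigroup_algebra S\<^esub> y = x + y"
  "\<one>\<^bsub>semigroup_algebra S\<^esub> = 1"
  "\<zero>\<^bsub>semigroup_algebra S\<^esub> = 0"
  by (simp_all add: semigroup_algebra_def)

lemma keys_add_subset:
  "Poly_Mapping.keys f \<subseteq> S \<Longrightarrow> Poly_Mapping.keys g \<subseteq> S \<Longrightarrow> Poly_Mapping.keys (f + g) \<subseteq> S"
  using keys_add[of f g] by blast

lemma keys_mult_subset:
  assumes "add_submonoid S" "Poly_Mapping.keys f \<subseteq> S" "Poly_Mapping.keys g \<subseteq> S"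
  shows "Poly_Mapping.keys (f * g) \<subseteq> S"
  using keys_mult[of f g] assms unfolding add_submonoid_def by blast

lemma semigroup_algebra_cring:
  assumes "add_submonoid S"
  shows "cring (semigroup_algebra S :: ('m::ab_group_add \<Rightarrow>\<^sub>0 'k::field_char_0) ring)"
proof (rule cringI)
  show "abelian_group (semigroup_algebra S :: ('m \<Rightarrow>\<^sub>0 'k) ring)"
  proof (rule abelian_groupI)
    fix x :: "'m \<Rightarrow>\<^sub>0 'k"
    assume "x \<in> carrier (semigroup_algebra S)"
    then show "\<exists>y \<in> carrier (semigroup_algebra S).
        y \<oplus>\<^bsub>semigroup_algebra S\<^esub> x = \<zero>\<^bsub>semigroup_algebra S\<^esub>"
      by (intro bexI[of _ "- x"]) auto
  qed (simp_all add: keys_add_subset algebra_simps)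
  show "comm_monoid (semigroup_algebra S :: ('m \<Rightarrow>\<^sub>0 'k) ring)"
  proof (rule comm_monoidI)
    show "\<one>\<^bsub>semigroup_algebra S\<^esub> \<in> carrier (semigroup_algebra S :: ('m \<Rightarrow>\<^sub>0 'k) ring)"
      using assms by (simp add: add_submonoid_def)
  next
    fix x y :: "'m \<Rightarrow>\<^sub>0 'k"
    assume "x \<in> carrier (semigroup_algebra S)" "y \<in> carrier (semigroup_algebra S)"
    then show "x \<otimes>\<^bsub>semigroup_algebra S\<^esub> y \<in> carrier (semigroup_algebra S)"
      using keys_mult_subset[OF assms] by simp
  qed (simp_all add: algebra_simps)
qed (simp add: algebra_simps)

lemma monomial_ideal_is_ideal:
  assumes "add_submonoid S" "A \<subseteq> S"
  shows "ideal (monomial_ideal S A)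
    (semigroup_algebra S :: ('m::ab_group_add \<Rightarrow>\<^sub>0 'k::field_char_0) ring)"
proof -
  interpret cring "semigroup_algebra S :: ('m \<Rightarrow>\<^sub>0 'k) ring"
    by (rule semigroup_algebra_cring[OF assms(1)])
  show ?thesis
    unfolding monomial_ideal_def
    by (rule genideal_ideal) (use assms(2) in \<open>auto simp: mono_x_def\<close>)
qed

lemma single_in_ideal_iff:
  fixes I :: "('m::ab_group_add \<Rightarrow>\<^sub>0 'k::field_char_0) set"
  assumes S: "add_submonoid S" and I: "ideal I (semigroup_algebra S)" and c: "c \<noteq> 0"
    and m: "m \<in> S"
  shows "Poly_Mapping.single m c \<in> I \<longleftrightarrow> m \<in> ideal_supp S I"
proof -
  have scalar: "Poly_Mapping.single 0 t \<in> carrier (semigroup_algebra S)" for t :: 'k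
    using S by (auto simp: add_submonoid_def)
  have mult: "Poly_Mapping.single 0 t * f \<in> I" if "f \<in> I" for t f
    using ideal.I_l_closed[OF I that scalar] by simp
  show ?thesis
  proof
    assume "Poly_Mapping.single m c \<in> I"
    from mult[OF this, of "inverse c"] show "m \<in> ideal_supp S I"
      using c m by (simp add: ideal_supp_def mono_x_def mult_single)
  next
    assume "m \<in> ideal_supp S I"
    then have "mono_x m \<in> I" by (simp add: ideal_supp_def)
    from mult[OF this, of c] show "Poly_Mapping.single m c \<in> I"
      by (simp add: mono_x_def mult_single)
  qed
qed

text \<open>
  Absorption by the ideal: as soon as one multiple of \<open>\<alpha>\<close> lies in the support, the same multiple
  moves every monomial of the algebra into the ideal.
\<close>

lemma ideal_supp_add:
  fixes I :: "('m::ab_group_add \<Rightarrow>\<^sub>0 'k::field_char_0) set"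
  assumes S: "add_submonoid S" and I: "ideal I (semigroup_algebra S)"
    and s: "s \<in> ideal_supp S I" and m: "m \<in> S"
  shows "m + s \<in> ideal_supp S I"
proof -
  have "mono_x m \<otimes>\<^bsub>semigroup_algebra S\<^esub> mono_x s \<in> I"
    using s m by (intro ideal.I_l_closed[OF I]) (auto simp: ideal_supp_def mono_x_def)
  then show ?thesis
    using S s m by (simp add: ideal_supp_def mono_x_def mult_single add_submonoid_def)
qed

section \<open>Homogeneous maps and their iterates\<close>

lemma additive_multiple:
  fixes p :: "'m::ab_group_add \<Rightarrow> 'b::ring_1"
  assumes "Modules.additive p"
  shows "p (\<Sum>j<i. \<alpha>) = of_nat i * p \<alpha>"
  by (induction i)
    (simp_all add: additive.zero[OF assms] additive.add[OF assms] algebra_simps)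

lemma lookup_partial_map:
  "Poly_Mapping.lookup (partial_map \<alpha> p f) n = p (n - \<alpha>) * Poly_Mapping.lookup f (n - \<alpha>)"
proof -
  have "Poly_Mapping.lookup (partial_map \<alpha> p f) n =
      (\<Sum>m\<in>Poly_Mapping.keys f. if m = n - \<alpha> then p m * Poly_Mapping.lookup f m else 0)"
    unfolding partial_map_def lookup_sum
    by (intro sum.cong) (auto simp: lookup_single when_def eq_diff_eq)
  also have "\<dots> = p (n - \<alpha>) * Poly_Mapping.lookup f (n - \<alpha>)"
    by (simp add: in_keys_iff)
  finally show ?thesis .
qed

lemma partial_map_0 [simp]: "partial_map \<alpha> p 0 = 0"
  by (simp add: partial_map_def)

lemma partial_map_add: "partial_map \<alpha> p (f + g) = partial_map \<alpha> p f + partial_map \<alpha> p g"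
  by (intro poly_mapping_eqI) (simp add: lookup_partial_map lookup_add algebra_simps)

lemma partial_map_funpow_add:
  "(partial_map \<alpha> p ^^ l) (f + g) = (partial_map \<alpha> p ^^ l) f + (partial_map \<alpha> p ^^ l) g"
  by (induction l) (simp_all add: partial_map_add)

lemma partial_map_single:
  "partial_map \<alpha> p (Poly_Mapping.single m c) = Poly_Mapping.single (m + \<alpha>) (p m * c)"
  by (intro poly_mapping_eqI) (auto simp: lookup_partial_map lookup_single when_def eq_diff_eq)

lemma partial_map_funpow_single:
  fixes p :: "'m::ab_group_add \<Rightarrow> 'k::field_char_0"
  assumes p: "Modules.additive p"
  shows "(partial_map \<alpha> p ^^ l) (Poly_Mapping.single m c) =
    Poly_Mapping.single (m + (\<Sum>i<l. \<alpha>)) ((\<Prod>i<l. p m + of_nat i * p \<alpha>) * c)"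
  by (induction l)
    (simp_all add: partial_map_single additive.add[OF p] additive_multiple[OF p] ac_simps)

lemma sum_singles: "(\<Sum>m\<in>Poly_Mapping.keys f. Poly_Mapping.single m (Poly_Mapping.lookup f m)) = f"
  by (intro poly_mapping_eqI) (simp add: lookup_sum lookup_single when_def in_keys_iff)

section \<open>Descent to the quotient\<close>

text \<open>
  A coset of an element of the algebra consists of elements of the algebra. Since \<open>D\<close> takes cosets
  to cosets, the representative \<open>d f\<close> of a value of \<open>D\<close> must itself be supported in \<open>S\<close>. For outer
  pairs this replaces the description of \<open>S\<close> by the inequalities of its dual rays.
\<close>

lemma induced_map_preserves_algebra:
  assumes I: "ideal I (semigroup_algebra S)"
    and D: "derivation_quotient S I D" and d: "induces S I d D"
    and f: "f \<in> carrier (semigroup_algebra S)"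
  shows "d f \<in> carrier (semigroup_algebra S)"
proof -
  let ?R = "semigroup_algebra S"
  interpret ideal I ?R by (rule I)
  have "I +>\<^bsub>?R\<^esub> f \<in> carrier (?R Quot I)"
    unfolding FactRing_def A_RCOSETS_def' using f by force
  moreover have "D \<in> carrier (?R Quot I) \<rightarrow> carrier (?R Quot I)"
    using D unfolding derivation_quotient_def alg_derivation_def by blast
  ultimately have "D (I +>\<^bsub>?R\<^esub> f) \<in> carrier (?R Quot I)"
    by (rule funcset_mem[rotated])
  then have "I +>\<^bsub>?R\<^esub> d f \<in> a_rcosets\<^bsub>?R\<^esub> I"
    using d f by (simp only: induces_def FactRing_def partial_object.simps)
  then obtain g where g: "g \<in> carrier ?R" and eq: "I +>\<^bsub>?R\<^esub> d f = I +>\<^bsub>?R\<^esub> g"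
    unfolding A_RCOSETS_def' by blast
  have "d f \<in> I +>\<^bsub>?R\<^esub> d f"
    using additive_subgroup.zero_closed[OF is_additive_subgroup]
    by (auto simp: a_r_coset_def' intro: bexI[of _ 0])
  then have "d f \<in> I +>\<^bsub>?R\<^esub> g"
    by (simp only: eq)
  then obtain i where i: "i \<in> I" and df: "d f = i + g"
    unfolding a_r_coset_def' by auto
  have "i \<in> carrier ?R" using i a_subset by (rule subsetD[rotated])
  with g show ?thesis
    by (simp add: df keys_add_subset)
qed

lemma coset_eq_ideal_iff:
  assumes I: "ideal I (semigroup_algebra S)" and f: "f \<in> carrier (semigroup_algebra S)"
  shows "I +>\<^bsub>semigroup_algebra S\<^esub> f = I \<longleftrightarrow> f \<in> I"
proof -
  interpret ideal I "semigroup_algebra S" by (rule I)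
  show ?thesis
    using ideal.rcos_const_imp_mem[OF I f] a_rcos_const by blast
qed

text \<open>
  All of \<open>I\<close> is one coset, the one of \<open>0\<close>, so the values of \<open>d\<close> on \<open>I\<close> all represent \<open>D\<close> of that
  coset, which is again \<open>I\<close> because \<open>d 0 = 0\<close>.
\<close>

lemma induced_map_preserves_ideal:
  assumes I: "ideal I (semigroup_algebra S)"
    and D: "derivation_quotient S I D" and d: "induces S I d D" and d0: "d 0 = 0"
    and f: "f \<in> I"
  shows "d f \<in> I"
proof -
  let ?R = "semigroup_algebra S"
  interpret ideal I ?R by (rule I)
  have fR: "f \<in> carrier ?R" using f a_subset by blast
  have zero: "0 \<in> I" "0 \<in> carrier ?R"
    using additive_subgroup.zero_closed[OF is_additive_subgroup] by auto
  have "I +>\<^bsub>?R\<^esub> d f = D (I +>\<^bsub>?R\<^esub> f)"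
    using d fR by (simp add: induces_def)
  also have "\<dots> = D (I +>\<^bsub>?R\<^esub> 0)"
    using coset_eq_ideal_iff[OF I] f fR zero by metis
  also have "\<dots> = I +>\<^bsub>?R\<^esub> 0"
    using d zero d0 by (simp add: induces_def)
  also have "\<dots> = I"
    using coset_eq_ideal_iff[OF I] zero by metis
  finally show ?thesis
    using coset_eq_ideal_iff[OF I induced_map_preserves_algebra[OF I D d fR]] by blast
qed

lemma locally_nilpotent_iff_funpow_in_ideal:
  assumes I: "ideal I (semigroup_algebra S)"
    and D: "derivation_quotient S I D" and d: "induces S I d D"
  shows "locally_nilpotent (semigroup_algebra S Quot I) D \<longleftrightarrow>
    (\<forall>f\<in>carrier (semigroup_algebra S). \<exists>l. (d ^^ l) f \<in> I)"
proof -
  let ?R = "semigroup_algebra S"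
  have closed: "(d ^^ l) f \<in> carrier ?R" if "f \<in> carrier ?R" for l f
    by (induction l)
      (use that induced_map_preserves_algebra[OF I D d] in \<open>simp_all del: semigroup_algebra_simps\<close>)
  have "(D ^^ l) (I +>\<^bsub>?R\<^esub> f) = I +>\<^bsub>?R\<^esub> (d ^^ l) f" if "f \<in> carrier ?R" for l f
    by (induction l)
      (use d closed[OF that] in \<open>simp_all add: induces_def del: semigroup_algebra_simps\<close>)
  then have "(D ^^ l) (I +>\<^bsub>?R\<^esub> f) = I \<longleftrightarrow> (d ^^ l) f \<in> I" if "f \<in> carrier ?R" for l f
    using coset_eq_ideal_iff[OF I closed[OF that]] that by metis
  then show ?thesis
    by (auto simp: locally_nilpotent_def FactRing_def A_RCOSETS_def'
        simp del: semigroup_algebra_simps)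
qed

text \<open>
  The elements that some power of \<open>\<partial>\<close> moves into \<open>I\<close> form an additive subset: exponents for the
  summands may be added up, since \<open>\<partial>\<close> preserves \<open>I\<close>. Every element is a finite sum of terms
  \<open>c x\<^sup>m\<close>, and such a term with \<open>c \<noteq> 0\<close> lies in \<open>I\<close> exactly if \<open>x\<^sup>m\<close> does.
\<close>

lemma locally_nilpotent_iff_monomials:
  fixes I :: "('m::ab_group_add \<Rightarrow>\<^sub>0 'k::field_char_0) set"
  assumes S: "add_submonoid S" and I: "ideal I (semigroup_algebra S)"
    and D: "derivation_quotient S I D" and d: "induces S I (partial_map \<alpha> p) D"
    and p: "Modules.additive p"
  shows "locally_nilpotent (semigroup_algebra S Quot I) D \<longleftrightarrow>
    (\<forall>m\<in>S. \<exists>l. (\<exists>i<l. p m + of_nat i * p \<alpha> = 0) \<or> m + (\<Sum>i<l. \<alpha>) \<in> ideal_supp S I)"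
proof -
  let ?R = "semigroup_algebra S :: ('m \<Rightarrow>\<^sub>0 'k) ring" and ?d = "partial_map \<alpha> p"
  interpret ideal I ?R by (rule I)
  have zero: "0 \<in> I"
    using additive_subgroup.zero_closed[OF is_additive_subgroup] by simp
  have add: "f + g \<in> I" if "f \<in> I" "g \<in> I" for f g
    using additive_subgroup.a_closed[OF is_additive_subgroup that] by simp
  have closed: "(?d ^^ l) f \<in> carrier ?R" if "f \<in> carrier ?R" for l f
    by (induction l)
      (use that induced_map_preserves_algebra[OF I D d] in \<open>simp_all del: semigroup_algebra_simps\<close>)
  have stays: "(?d ^^ l) f \<in> I" if "f \<in> I" for l f
    by (induction l) (use that induced_map_preserves_ideal[OF I D d] in simp_all)
  have mono: "(?d ^^ l) (Poly_Mapping.single m c) \<in> I \<longleftrightarrow>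
      (\<exists>i<l. p m + of_nat i * p \<alpha> = 0) \<or> m + (\<Sum>i<l. \<alpha>) \<in> ideal_supp S I"
    if "m \<in> S" "c \<noteq> 0" for l m c
  proof (cases "\<exists>i<l. p m + of_nat i * p \<alpha> = 0")
    case True
    then have "(\<Prod>i<l. p m + of_nat i * p \<alpha>) = 0" by (intro prod_zero) auto
    then have "(?d ^^ l) (Poly_Mapping.single m c) = 0"
      by (simp only: partial_map_funpow_single[OF p] mult_zero_left single_zero)
    with True zero show ?thesis by simp
  next
    case False
    then have nz: "(\<Prod>i<l. p m + of_nat i * p \<alpha>) * c \<noteq> 0" using that by auto
    have "(?d ^^ l) (Poly_Mapping.single m c) \<in> carrier ?R"
      by (rule closed) (use that in simp)
    then have "m + (\<Sum>i<l. \<alpha>) \<in> S"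
      using nz by (simp add: partial_map_funpow_single[OF p] del: mult_eq_0_iff)
    from single_in_ideal_iff[OF S I nz this] False show ?thesis
      by (simp only: partial_map_funpow_single[OF p] simp_thms)
  qed
  have sums: "\<exists>l. (?d ^^ l) (\<Sum>m\<in>K. h m) \<in> I"
    if "finite K" "\<forall>m\<in>K. \<exists>l. (?d ^^ l) (h m) \<in> I" for K :: "'m set" and h
    using that
  proof (induction K rule: finite_induct)
    case empty
    show ?case using zero by (intro exI[of _ 0]) simp
  next
    case (insert x K)
    obtain a where a: "(?d ^^ a) (h x) \<in> I"
      using insert.prems by blast
    obtain b where b: "(?d ^^ b) (\<Sum>m\<in>K. h m) \<in> I"
      using insert.IH insert.prems by blast
    have "(?d ^^ (b + a)) (h x) \<in> I" "(?d ^^ (a + b)) (\<Sum>m\<in>K. h m) \<in> I"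
      using stays[OF a, of b] stays[OF b, of a] by (simp_all add: funpow_add)
    then have "(?d ^^ (a + b)) (h x + (\<Sum>m\<in>K. h m)) \<in> I"
      by (simp add: partial_map_funpow_add add ac_simps)
    then show ?case using insert by auto
  qed
  show ?thesis
    unfolding locally_nilpotent_iff_funpow_in_ideal[OF I D d]
  proof
    assume L: "\<forall>f\<in>carrier ?R. \<exists>l. (?d ^^ l) f \<in> I"
    show "\<forall>m\<in>S. \<exists>l. (\<exists>i<l. p m + of_nat i * p \<alpha> = 0) \<or> m + (\<Sum>i<l. \<alpha>) \<in> ideal_supp S I"
    proof
      fix m assume m: "m \<in> S"
      then have "Poly_Mapping.single m 1 \<in> carrier ?R" by simp
      with L mono[OF m] show
        "\<exists>l. (\<exists>i<l. p m + of_nat i * p \<alpha> = 0) \<or> m + (\<Sum>i<l. \<alpha>) \<in> ideal_supp S I"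
        using zero_neq_one by metis
    qed
  next
    assume R: "\<forall>m\<in>S. \<exists>l. (\<exists>i<l. p m + of_nat i * p \<alpha> = 0) \<or> m + (\<Sum>i<l. \<alpha>) \<in> ideal_supp S I"
    show "\<forall>f\<in>carrier ?R. \<exists>l. (?d ^^ l) f \<in> I"
    proof
      fix f assume f: "f \<in> carrier ?R"
      have "\<forall>m\<in>Poly_Mapping.keys f.
        \<exists>l. (?d ^^ l) (Poly_Mapping.single m (Poly_Mapping.lookup f m)) \<in> I"
      proof
        fix m assume "m \<in> Poly_Mapping.keys f"
        then have "m \<in> S" "Poly_Mapping.lookup f m \<noteq> 0"
          using f by (auto simp: in_keys_iff)
        with R mono show "\<exists>l. (?d ^^ l) (Poly_Mapping.single m (Poly_Mapping.lookup f m)) \<in> I"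
          by metis
      qed
      from sums[OF finite_keys this] show "\<exists>l. (?d ^^ l) f \<in> I"
        by (simp add: sum_singles)
    qed
  qed
qed

section \<open>The classification\<close>

lemma dual_rays_subset_dual_semigroup: "dual_rays S \<subseteq> dual_semigroup S"
proof
  fix \<rho> assume "\<rho> \<in> dual_rays S"
  then have "nat_multiples \<rho> \<subseteq> dual_semigroup S"
    by (auto simp: dual_rays_def ray_generators_def semigroup_ray_def semigroup_face_def)
  moreover have "(\<Sum>i<Suc 0. \<rho>) \<in> nat_multiples \<rho>"
    unfolding nat_multiples_def by (rule rangeI)
  ultimately show "\<rho> \<in> dual_semigroup S" by auto
qed

theorem theorem3p7:
  fixes n :: nat
    and \<iota> :: "'m::ab_group_add \<Rightarrow> 'v::real_vector"
    and S A :: "'m set"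
    and I :: "('m \<Rightarrow>\<^sub>0 'k::field_char_0) set"
    and \<alpha> :: 'm
    and p :: "'m \<Rightarrow> 'k"
    and D :: "('m \<Rightarrow>\<^sub>0 'k) set \<Rightarrow> ('m \<Rightarrow>\<^sub>0 'k) set"
  assumes "lattice_in_realification n \<iota>"
    and "affine_semigroup S"
    and "minimally_embedded S"
    and "saturated \<iota> S"
    and "pointed \<iota> S"
    and "finite A" and "A \<subseteq> S"
    and "I = monomial_ideal S A"
    and "Modules.additive p"
    and "liftable_homogeneous_derivation S A I \<alpha> p D"
  shows "locally_nilpotent (semigroup_algebra S Quot I) D \<longleftrightarrow>
      (\<exists>\<rho>\<in>dual_rays S. \<exists>c::'k. \<alpha> \<in> roots_ideal S A I \<rho> \<and> p = (\<lambda>m. c * of_int (\<rho> m)))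
    \<or> (\<alpha> \<in> S \<and> nat_multiples \<alpha> \<inter> ideal_supp S I \<noteq> {})
    \<or> (\<alpha> \<in> S \<and> nat_multiples \<alpha> \<inter> ideal_supp S I = {} \<and>
        (\<forall>m\<in>S - {m. p m = 0}. (\<lambda>x. m + x) ` nat_multiples \<alpha> \<inter> ideal_supp S I \<noteq> {}))"
    (is "?LN \<longleftrightarrow> ?outer \<or> ?ii \<or> ?iii")
proof -
  have S: "add_submonoid S"
    using assms(2) add_submonoid_hull by (auto simp: affine_semigroup_def)
  have I: "ideal I (semigroup_algebra S)"
    using monomial_ideal_is_ideal[OF S assms(7)] assms(8) by simp
  have pair: "inner_pair S \<alpha> p \<or> outer_pair S A I \<alpha> p"
    using assms(10) by (simp add: liftable_homogeneous_derivation_def)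
  have LN: "?LN \<longleftrightarrow>
    (\<forall>m\<in>S. \<exists>l. (\<exists>i<l. p m + of_nat i * p \<alpha> = 0) \<or> m + (\<Sum>i<l. \<alpha>) \<in> ideal_supp S I)"
    by (rule locally_nilpotent_iff_monomials[OF S I _ _ assms(9)])
      (use assms(10) in \<open>auto simp: liftable_homogeneous_derivation_def liftable_def\<close>)
  have in_multiples: "(\<Sum>i<l. \<alpha>) \<in> nat_multiples \<alpha>" for l :: nat
    unfolding nat_multiples_def by (rule rangeI)
  show ?thesis
  proof
    assume ?LN
    note crit = this[unfolded LN]
    show "?outer \<or> ?ii \<or> ?iii"
    proof (cases "outer_pair S A I \<alpha> p")
      case True
      then have ?outer by (auto simp: outer_pair_def ray_line_def)
      then show ?thesis ..
    next
      case False
      with pair have \<alpha>: "\<alpha> \<in> S" by (simp add: inner_pair_def)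
      show ?thesis
      proof (cases "nat_multiples \<alpha> \<inter> ideal_supp S I = {}")
        case False
        with \<alpha> show ?thesis by blast
      next
        case True
        \<comment> \<open>Otherwise every power of \<open>\<partial>\<close> takes \<open>x\<^sup>\<alpha>\<close> to a nonzero multiple of some \<open>x\<^bsup>k\<alpha>\<^esup>\<close>.\<close>
        have p\<alpha>: "p \<alpha> = 0"
        proof (rule ccontr)
          assume nz: "p \<alpha> \<noteq> 0"
          have "p \<alpha> + of_nat i * p \<alpha> = of_nat (Suc i) * p \<alpha>" for i
            by (simp add: algebra_simps)
          with nz have "p \<alpha> + of_nat i * p \<alpha> \<noteq> 0" for i
            by (simp del: of_nat_Suc)
          with crit \<alpha> obtain l :: nat where "\<alpha> + (\<Sum>i<l. \<alpha>) \<in> ideal_supp S I" by blast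
          moreover have "\<alpha> + (\<Sum>i<l. \<alpha>) = (\<Sum>i<Suc l. \<alpha>)"
            by (simp add: ac_simps)
          ultimately show False
            using True in_multiples[of "Suc l"] by (simp only: disjoint_iff)
        qed
        have "(\<lambda>x. m + x) ` nat_multiples \<alpha> \<inter> ideal_supp S I \<noteq> {}" if "m \<in> S" "p m \<noteq> 0" for m
        proof -
          from that p\<alpha> have "p m + of_nat i * p \<alpha> \<noteq> 0" for i by simp
          with crit that(1) obtain l :: nat where "m + (\<Sum>i<l. \<alpha>) \<in> ideal_supp S I" by blast
          then show ?thesis using in_multiples[of l] by blast
        qed
        with \<alpha> True show ?thesis by blast
      qed
    qed
  next
    assume "?outer \<or> ?ii \<or> ?iii"
    then show ?LN
    proof (elim disjE)
      assume ?outer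
      then obtain \<rho> c where \<rho>: "\<rho> \<in> dual_rays S" "\<alpha> \<in> roots S \<rho>"
        and p: "p = (\<lambda>m. c * of_int (\<rho> m))"
        unfolding roots_ideal_def by blast
      show ?LN
        unfolding LN
      proof
        fix m assume "m \<in> S"
        then have "\<rho> m \<ge> 0"
          using \<rho>(1) dual_rays_subset_dual_semigroup by (auto simp: dual_semigroup_def)
        then have "p m + of_nat (nat (\<rho> m)) * p \<alpha> = 0"
          using \<rho>(2) by (simp add: p roots_def)
        then show "\<exists>l. (\<exists>i<l. p m + of_nat i * p \<alpha> = 0) \<or> m + (\<Sum>i<l. \<alpha>) \<in> ideal_supp S I"
          using lessI by blast
      qed
    next
      assume ?ii
      then obtain l :: nat where "(\<Sum>i<l. \<alpha>) \<in> ideal_supp S I"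
        by (auto simp: nat_multiples_def)
      then show ?LN
        unfolding LN using ideal_supp_add[OF S I] by blast
    next
      assume ?iii
      show ?LN
        unfolding LN
      proof
        fix m assume m: "m \<in> S"
        show "\<exists>l. (\<exists>i<l. p m + of_nat i * p \<alpha> = 0) \<or> m + (\<Sum>i<l. \<alpha>) \<in> ideal_supp S I"
        proof (cases "p m = 0")
          case True
          then show ?thesis by (intro exI[of _ 1]) simp
        next
          case False
          with m \<open>?iii\<close> have "(\<lambda>x. m + x) ` nat_multiples \<alpha> \<inter> ideal_supp S I \<noteq> {}" by blast
          then show ?thesis unfolding nat_multiples_def by blast
        qed
      qed
    qed
  qed
qed

end
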